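(* Let $(\mathit{Init},\delta,\mathit{Bad})$ be a transition system over $n$ Boolean variables and let $k\in\mathbb{N}$. If there is an inductive invariant $I$ that is backwards $k$-fenced and that is a monotone DNF formula with $m$ terms, then the algorithm ITP-Inference-TermMin$(\mathit{Init},\delta,\mathit{Bad},k)$ converges to an inductive invariant (for every resolution of its arbitrary choices) using $O(m)$ inductiveness checks, $O(mn)$ $k$-BMC checks, and $O(mn)$ time.
   Context: Transition systems. $\Sigma=\{p_1,\dots,p_n\}$ is a finite set of Boolean variables; a state is a valuation of $\Sigma$; a formula over $\Sigma$ is identified with the set of states satisfying it, and $\varphi\Longrightarrow\psi$ means that $\varphi\to\psi$ is valid. A transition system is a triple $(\mathit{Init},\delta,\mathit{Bad})$ with $\mathit{Init},\mathit{Bad}$ formulas over $\Sigma$ and $\delta$ a formula over $\Sigma\uplus\Sigma'$ ($\Sigma'$ a primed copy), describing pairs (pre-state, post-state). Standing assumptions: $\mathit{Init}\not\equiv\mathit{false}$, $\mathit{Bad}\not\equiv\mathit{true},\mathit{false}$, $\mathit{Init}\Longrightarrow\neg\mathit{Bad}$. An inductive invariant is a formula $I$ over $\Sigma$ with (i) $\mathit{Init}\Longrightarrow I$, (ii) $I\wedge\delta\Longrightarrow I'$, (iii) $I\Longrightarrow\neg\mathit{Bad}$, where $I'$ is $I$ with variables primed. Bounded reachability. $\delta^{\le k}(S)$ is the set of states reachable from some state in $S$ by an execution of $\delta$ of at most $k$ steps; $(\delta^{-1})^{\le k}(\mathit{Bad})$ is the set of states from which some state of $\mathit{Bad}$ is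 reachable in at most $k$ steps. Fence condition. Two states are neighbors if they differ in exactly one variable. The outer boundary of $I$ is $\partial^-(I)=\{\sigma\not\models I : \sigma \text{ has a neighbor } \models I\}$. An inductive invariant $I$ is backwards $k$-fenced if $\partial^-(I)\subseteq(\delta^{-1})^{\le k}(\mathit{Bad})$. A term is a conjunction of literals (also viewed as a set of literals); a DNF formula is a disjunction of terms; it is monotone if all variables occur only positively. $\mathrm{cube}(\sigma)$ is the conjunction of all literals true in $\sigma$. Algorithm ITP-Inference-TermMin$(\mathit{Init},\delta,\mathit{Bad},k)$: set $\varphi\leftarrow\mathit{Init}$. While $\varphi$ is not inductive: take any counterexample to induction $(\sigma,\sigma')\models\varphi\wedge\delta\wedge\neg\varphi'$; if $\delta^{\le k}(\{\sigma'\})\cap\mathit{Bad}\neq\emptyset$, the run with bound $k$ fails (restart with larger $k$); otherwise set $d\leftarrow\mathrm{cube}(\sigma')$ and, for each literal $\ell$ of $d$ in arbitrary order, if $\delta^{\le k}(d\setminus\{\ell\})\cap\mathit{Bad}=\emptyset$ set $d\leftarrow d\setminus\{\ell\}$; then set $\varphi\leftarrow\varphi\vee d$. When $\varphi$ is inductive, return $\varphi$. "Converges to an inductive invariant" means that it terminates without failing with bound $k$ and returns an inductive invariant. Complexity measure. An inductiveness check decides whether a candidate is an inductive invariant and returns a counterexample if not; a $k$-BMC check decides whether $\delta^{\le k}(\psi)\cap\mathit{Bad}=\emptyset$ or whether $\delta^{\le k}(\mathit{Init})\cap\psi=\emptyset$ for a given $\psi$. Time counts each such check (SAT oracle call) as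 one step. *)

theory Defs
  imports Main "HOL-Library.FuncSet"
begin

text \<open>
  The propositional variables are \<open>0, \<dots>, n - 1\<close>. A state is a valuation of them (extensional,
  so that states are equal iff they agree on these variables). Formulas are identified with
  their sets of states, and a transition formula with a set of (pre-state, post-state) pairs.
\<close>

type_synonym state = "nat \<Rightarrow> bool"
type_synonym fm = "state set"
type_synonym trans = "(state \<times> state) set"

definition states :: "nat \<Rightarrow> state set" where
  "states n = {..<n} \<rightarrow>\<^sub>E (UNIV :: bool set)"

definition transition_system :: "nat \<Rightarrow> fm \<Rightarrow> trans \<Rightarrow> fm \<Rightarrow> bool" where
  "transition_system n Init \<delta> Bad \<longleftrightarrow>
     Init \<subseteq> states n \<and> \<delta> \<subseteq> states n \<times> states n \<and> Bad \<subseteq> states n \<and>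
     Init \<noteq> {} \<and> Bad \<noteq> {} \<and> Bad \<noteq> states n \<and> Init \<inter> Bad = {}"

definition inductive_invariant :: "nat \<Rightarrow> fm \<Rightarrow> trans \<Rightarrow> fm \<Rightarrow> fm \<Rightarrow> bool" where
  "inductive_invariant n Init \<delta> Bad I \<longleftrightarrow>
     I \<subseteq> states n \<and> Init \<subseteq> I \<and> \<delta> `` I \<subseteq> I \<and> I \<inter> Bad = {}"

definition reach_within :: "trans \<Rightarrow> nat \<Rightarrow> fm \<Rightarrow> fm" where
  "reach_within \<delta> k S = (\<Union>j\<le>k. (\<delta> ^^ j) `` S)"

definition neighbors :: "nat \<Rightarrow> state \<Rightarrow> state \<Rightarrow> bool" where
  "neighbors n \<sigma> \<tau> \<longleftrightarrow> card {i. i < n \<and> \<sigma> i \<noteq> \<tau> i} = 1"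

definition outer_boundary :: "nat \<Rightarrow> fm \<Rightarrow> fm" where
  "outer_boundary n I = {\<sigma> \<in> states n. \<sigma> \<notin> I \<and> (\<exists>\<tau>\<in>I. neighbors n \<sigma> \<tau>)}"

definition backwards_fenced :: "nat \<Rightarrow> trans \<Rightarrow> fm \<Rightarrow> nat \<Rightarrow> fm \<Rightarrow> bool" where
  "backwards_fenced n \<delta> Bad k I \<longleftrightarrow> outer_boundary n I \<subseteq> reach_within (\<delta>\<inverse>) k Bad"

datatype lit = Pos nat | Neg nat

fun lit_var :: "lit \<Rightarrow> nat" where
  "lit_var (Pos i) = i"
| "lit_var (Neg i) = i"

fun lit_true :: "state \<Rightarrow> lit \<Rightarrow> bool" where
  "lit_true \<sigma> (Pos i) \<longleftrightarrow> \<sigma> i"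
| "lit_true \<sigma> (Neg i) \<longleftrightarrow> \<not> \<sigma> i"

text \<open>A term is a set of literals, read as their conjunction; a DNF formula is a list of terms.\<close>

type_synonym trm = "lit set"
type_synonym dnf = "trm list"

definition term_states :: "nat \<Rightarrow> trm \<Rightarrow> fm" where
  "term_states n d = {\<sigma> \<in> states n. \<forall>l\<in>d. lit_true \<sigma> l}"

definition dnf_states :: "nat \<Rightarrow> dnf \<Rightarrow> fm" where
  "dnf_states n D = (\<Union>d\<in>set D. term_states n d)"

definition monotone_dnf :: "nat \<Rightarrow> dnf \<Rightarrow> bool" where
  "monotone_dnf n D \<longleftrightarrow> (\<forall>d\<in>set D. \<forall>l\<in>d. \<exists>i<n. l = Pos i)"

definition cube :: "nat \<Rightarrow> state \<Rightarrow> trm" where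
  "cube n \<sigma> = {l. lit_var l < n \<and> lit_true \<sigma> l}"

text \<open>
  The algorithm is a nondeterministic small-step machine that counts the resources used so far.
  Time charges one step for each check and, in addition, one step for each literal
  written (when forming a cube or adding a term to the candidate) or removed.
\<close>

record cost =
  ind_checks :: nat
  bmc_checks :: nat
  time :: nat

definition ind_check :: "cost \<Rightarrow> cost" where
  "ind_check c = c\<lparr>ind_checks := ind_checks c + 1, time := time c + 1\<rparr>"

definition bmc_check :: "cost \<Rightarrow> cost" where
  "bmc_check c = c\<lparr>bmc_checks := bmc_checks c + 1, time := time c + 1\<rparr>"

definition tick :: "nat \<Rightarrow> cost \<Rightarrow> cost" where
  "tick t c = c\<lparr>time := time c + t\<rparr>"

text \<open>
  Control points, with \<open>\<phi>\<close> the current candidate: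
  \<^item> \<open>Loop \<phi>\<close>: about to test the loop condition;
  \<^item> \<open>Cex \<phi> \<sigma>'\<close>: a counterexample to induction with post-state \<open>\<sigma>'\<close> was found;
  \<^item> \<open>Gen \<phi> d L\<close>: generalizing the term \<open>d\<close>, with the literals in \<open>L\<close> still to be tried;
  \<^item> \<open>Returned \<phi>\<close> and \<open>Failed\<close>: the run has ended.
\<close>

datatype control =
  Loop fm | Cex fm state | Gen fm trm "lit set" | Returned fm | Failed

type_synonym config = "control \<times> cost"

inductive itp_step :: "nat \<Rightarrow> trans \<Rightarrow> fm \<Rightarrow> nat \<Rightarrow> config \<Rightarrow> config \<Rightarrow> bool"
  for n :: nat and \<delta> :: trans and Bad :: fm and k :: nat where
  return:
    "\<delta> `` \<phi> \<subseteq> \<phi> \<Longrightarrow>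
     itp_step n \<delta> Bad k (Loop \<phi>, c) (Returned \<phi>, ind_check c)"
| counterexample:
    "\<sigma> \<in> \<phi> \<Longrightarrow> (\<sigma>, \<sigma>') \<in> \<delta> \<Longrightarrow> \<sigma>' \<notin> \<phi> \<Longrightarrow>
     itp_step n \<delta> Bad k (Loop \<phi>, c) (Cex \<phi> \<sigma>', ind_check c)"
| fail:
    "reach_within \<delta> k {\<sigma>'} \<inter> Bad \<noteq> {} \<Longrightarrow>
     itp_step n \<delta> Bad k (Cex \<phi> \<sigma>', c) (Failed, bmc_check c)"
| start_gen:
    "reach_within \<delta> k {\<sigma>'} \<inter> Bad = {} \<Longrightarrow>
     itp_step n \<delta> Bad k (Cex \<phi> \<sigma>', c)
       (Gen \<phi> (cube n \<sigma>') (cube n \<sigma>'), tick (card (cube n \<sigma>')) (bmc_check c))"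
| drop_lit:
    "l \<in> L \<Longrightarrow> reach_within \<delta> k (term_states n (d - {l})) \<inter> Bad = {} \<Longrightarrow>
     itp_step n \<delta> Bad k (Gen \<phi> d L, c) (Gen \<phi> (d - {l}) (L - {l}), tick 1 (bmc_check c))"
| keep_lit:
    "l \<in> L \<Longrightarrow> reach_within \<delta> k (term_states n (d - {l})) \<inter> Bad \<noteq> {} \<Longrightarrow>
     itp_step n \<delta> Bad k (Gen \<phi> d L, c) (Gen \<phi> d (L - {l}), bmc_check c)"
| add_term:
    "itp_step n \<delta> Bad k (Gen \<phi> d {}, c) (Loop (\<phi> \<union> term_states n d), tick (card d) c)"

definition itp_start :: "fm \<Rightarrow> config" where
  "itp_start Init = (Loop Init, \<lparr>ind_checks = 0, bmc_checks = 0, time = 0\<rparr>)"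

definition itp_reachable :: "nat \<Rightarrow> fm \<Rightarrow> trans \<Rightarrow> fm \<Rightarrow> nat \<Rightarrow> config \<Rightarrow> bool" where
  "itp_reachable n Init \<delta> Bad k cfg \<longleftrightarrow> (itp_step n \<delta> Bad k)\<^sup>*\<^sup>* (itp_start Init) cfg"

text \<open>
  Convergence for every resolution of the choices: there is no infinite run, and every run that
  cannot be continued has returned an inductive invariant (in particular it has not failed).
\<close>

definition itp_converges :: "nat \<Rightarrow> fm \<Rightarrow> trans \<Rightarrow> fm \<Rightarrow> nat \<Rightarrow> bool" where
  "itp_converges n Init \<delta> Bad k \<longleftrightarrow>
     \<not> (\<exists>run :: nat \<Rightarrow> config.
          run 0 = itp_start Init \<and> (\<forall>i. itp_step n \<delta> Bad k (run i) (run (Suc i)))) \<and>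
     (\<forall>cfg. itp_reachable n Init \<delta> Bad k cfg \<and> \<not> (\<exists>cfg'. itp_step n \<delta> Bad k cfg cfg') \<longrightarrow>
        (\<exists>J c. cfg = (Returned J, c) \<and> inductive_invariant n Init \<delta> Bad J))"

end

theory Submission
  imports Defs
begin

text \<open>
  The candidate never leaves \<open>I\<close>. A term that meets \<open>I\<close> but is not contained in it meets the
  outer boundary of \<open>I\<close>, hence reaches \<open>Bad\<close> within \<open>k\<close> steps by the fence condition; conversely
  a term contained in \<open>I\<close> cannot reach \<open>Bad\<close>. So generalization drops a literal iff the result
  still implies \<open>I\<close>, and produces a prime implicant of \<open>I\<close>. A prime implicant of a
  monotone DNF is one of its terms, and the term added contains the current counterexample,
  so every iteration adds a term of \<open>D\<close> that was not added before.
\<close>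

section \<open>Terms, cubes and the states they describe\<close>

lemma states_iff: "\<sigma> \<in> states n \<longleftrightarrow> (\<forall>i. \<not> i < n \<longrightarrow> \<sigma> i = undefined)"
  by (auto simp: states_def PiE_def extensional_def)

lemma term_states_mono: "d \<subseteq> d' \<Longrightarrow> term_states n d' \<subseteq> term_states n d"
  by (auto simp: term_states_def)

text \<open>A literal constrains a single variable, so copying one value from another state of the
  term cannot falsify it. This permits a walk between the two states inside the term.\<close>

lemma term_states_upd:
  assumes "\<sigma> \<in> term_states n d" "\<rho> \<in> term_states n d"
  shows "\<sigma>(i := \<rho> i) \<in> term_states n d"
proof -
  have "lit_true (\<sigma>(i := \<rho> i)) l" if "l \<in> d" for l
    using assms that by (cases l) (auto simp: term_states_def)
  then show ?thesis
    using assms by (auto simp: term_states_def states_iff)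
qed

lemma finite_cube: "finite (cube n \<sigma>)"
  and card_cube: "card (cube n \<sigma>) = n"
proof -
  have eq: "cube n \<sigma> = (\<lambda>i. if \<sigma> i then Pos i else Neg i) ` {..<n}"
    unfolding cube_def
  proof (intro set_eqI)
    fix l
    show "l \<in> {l. lit_var l < n \<and> lit_true \<sigma> l} \<longleftrightarrow>
      l \<in> (\<lambda>i. if \<sigma> i then Pos i else Neg i) ` {..<n}"
      by (cases l) (auto simp: image_iff)
  qed
  have "inj_on (\<lambda>i. if \<sigma> i then Pos i else Neg i) {..<n}"
    by (auto simp: inj_on_def split: if_splits)
  then show "card (cube n \<sigma>) = n"
    by (simp only: eq card_image card_lessThan)
  show "finite (cube n \<sigma>)"
    by (simp add: eq)
qed

lemma term_states_cube:
  assumes "\<sigma> \<in> states n"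
  shows "term_states n (cube n \<sigma>) = {\<sigma>}"
proof
  show "{\<sigma>} \<subseteq> term_states n (cube n \<sigma>)"
    using assms by (auto simp: term_states_def cube_def)
  show "term_states n (cube n \<sigma>) \<subseteq> {\<sigma>}"
  proof
    fix \<tau> assume \<tau>: "\<tau> \<in> term_states n (cube n \<sigma>)"
    have "\<tau> i = \<sigma> i" for i
    proof (cases "i < n")
      case True
      then have "(if \<sigma> i then Pos i else Neg i) \<in> cube n \<sigma>"
        by (simp add: cube_def)
      with \<tau> have "lit_true \<tau> (if \<sigma> i then Pos i else Neg i)"
        by (auto simp: term_states_def)
      then show ?thesis
        by (auto split: if_splits)
    next
      case False
      then show ?thesis
        using assms \<tau> by (auto simp: term_states_def states_iff)
    qed
    then show "\<tau> \<in> {\<sigma>}" by auto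
  qed
qed

section \<open>Bounded reachability\<close>

lemma reach_within_mono: "S \<subseteq> T \<Longrightarrow> reach_within \<delta> k S \<subseteq> reach_within \<delta> k T"
  by (auto simp: reach_within_def)

lemma reach_within_closed:
  assumes "\<delta> `` I \<subseteq> I" "S \<subseteq> I"
  shows "reach_within \<delta> k S \<subseteq> I"
proof -
  have "(\<delta> ^^ j) `` S \<subseteq> I" for j
    by (induction j) (use assms in \<open>auto simp: relcomp_Image\<close>)
  then show ?thesis
    by (auto simp: reach_within_def)
qed

lemma reach_within_converse:
  assumes "\<tau> \<in> reach_within (\<delta>\<inverse>) k Bad"
  shows "reach_within \<delta> k {\<tau>} \<inter> Bad \<noteq> {}"
proof -
  obtain j b where "j \<le> k" "b \<in> Bad" "(b, \<tau>) \<in> \<delta>\<inverse> ^^ j"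
    using assms by (auto simp: reach_within_def)
  moreover have "\<delta>\<inverse> ^^ j = (\<delta> ^^ j)\<inverse>"
  proof (induction j)
    case (Suc j)
    \<comment> \<open>\<open>relpow\<close> adds its new factor on the right, and the converse
      reverses the composition; \<open>relpow_commute\<close> then moves the factor back.\<close>
    have "\<delta>\<inverse> ^^ Suc j = (\<delta> O \<delta> ^^ j)\<inverse>"
      unfolding relpow.simps(2) Suc converse_relcomp ..
    then show ?case
      unfolding relpow_commute relpow.simps(2) .
  qed auto
  ultimately have "b \<in> reach_within \<delta> k {\<tau>}"
    by (auto simp: reach_within_def)
  with \<open>b \<in> Bad\<close> show ?thesis
    by auto
qed

text \<open>Changing \<open>\<sigma>\<close> into \<open>\<rho>\<close> one variable at a time stays in the term and leaves \<open>I\<close> at some point.\<close>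

lemma term_meets_outer_boundary:
  assumes "\<sigma> \<in> I" "\<sigma> \<in> term_states n d" "\<rho> \<in> term_states n d" "\<rho> \<notin> I"
  shows "term_states n d \<inter> outer_boundary n I \<noteq> {}"
  using assms(1,2)
proof (induction "card {i. i < n \<and> \<sigma> i \<noteq> \<rho> i}" arbitrary: \<sigma> rule: less_induct)
  case less
  have "\<sigma> \<noteq> \<rho>" using less.prems assms(4) by auto
  then obtain i where i: "\<sigma> i \<noteq> \<rho> i" by auto
  \<comment> \<open>From index \<open>n\<close> on, both states are
    \<open>undefined\<close>.\<close>
  then have "i < n"
    using less.prems(2) assms(3) by (metis (no_types, lifting) mem_Collect_eq states_iff term_states_def)
  let ?\<tau> = "\<sigma>(i := \<rho> i)"
  have \<tau>: "?\<tau> \<in> term_states n d"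
    using term_states_upd less.prems(2) assms(3) by blast
  show ?case
  proof (cases "?\<tau> \<in> I")
    case True
    have "{j. j < n \<and> ?\<tau> j \<noteq> \<rho> j} \<subset> {j. j < n \<and> \<sigma> j \<noteq> \<rho> j}"
      using i \<open>i < n\<close> by auto
    then have "card {j. j < n \<and> ?\<tau> j \<noteq> \<rho> j} < card {j. j < n \<and> \<sigma> j \<noteq> \<rho> j}"
      by (intro psubset_card_mono) auto
    then show ?thesis
      using less.hyps True \<tau> by blast
  next
    case False
    have "{j. j < n \<and> ?\<tau> j \<noteq> \<sigma> j} = {i}"
      using i \<open>i < n\<close> by auto
    then have "neighbors n ?\<tau> \<sigma>"
      by (simp add: neighbors_def)
    then have "?\<tau> \<in> outer_boundary n I"
      using False less.prems(1) \<tau> unfolding outer_boundary_def term_states_def by blast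
    then show ?thesis
      using \<tau> by blast
  qed
qed

lemma fenced_term_subset:
  assumes "backwards_fenced n \<delta> Bad k I" "\<sigma> \<in> I" "\<sigma> \<in> term_states n d"
    and "reach_within \<delta> k (term_states n d) \<inter> Bad = {}"
  shows "term_states n d \<subseteq> I"
proof (rule ccontr)
  assume "\<not> term_states n d \<subseteq> I"
  then obtain \<tau> where \<tau>: "\<tau> \<in> term_states n d" "\<tau> \<in> outer_boundary n I"
    using term_meets_outer_boundary[OF assms(2,3)] by blast
  then have "reach_within \<delta> k {\<tau>} \<inter> Bad \<noteq> {}"
    using assms(1) reach_within_converse unfolding backwards_fenced_def by blast
  moreover have "reach_within \<delta> k {\<tau>} \<subseteq> reach_within \<delta> k (term_states n d)"
    using \<tau> by (intro reach_within_mono) auto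
  ultimately show False
    using assms(4) by blast
qed

section \<open>Prime implicants of monotone DNF formulas\<close>

lemma monotone_dnf_upd_True:
  assumes "monotone_dnf n D" "\<sigma> \<in> dnf_states n D" "i < n"
  shows "\<sigma>(i := True) \<in> dnf_states n D"
proof -
  obtain t where t: "t \<in> set D" "\<sigma> \<in> term_states n t"
    using assms(2) by (auto simp: dnf_states_def)
  have "lit_true (\<sigma>(i := True)) l" if "l \<in> t" for l
  proof -
    have "\<exists>j<n. l = Pos j"
      using assms(1) t(1) that by (simp add: monotone_dnf_def)
    then show ?thesis
      using t(2) that by (auto simp: term_states_def)
  qed
  then have "\<sigma>(i := True) \<in> term_states n t"
    using t(2) assms(3) by (auto simp: term_states_def states_iff)
  then show ?thesis
    using t(1) by (auto simp: dnf_states_def)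
qed

text \<open>A negative literal could be dropped, since monotonicity lets its variable be raised
  again. What remains is a positive term with a least model; a term of \<open>D\<close> true there
  is a subset of \<open>d\<close>, and primality forces equality.\<close>

lemma monotone_dnf_prime_implicant:
  assumes mono: "monotone_dnf n D" and d: "d \<subseteq> cube n \<sigma>"
    and implicant: "term_states n d \<subseteq> dnf_states n D"
    and prime: "\<And>l. l \<in> d \<Longrightarrow> \<not> term_states n (d - {l}) \<subseteq> dnf_states n D"
  shows "d \<in> set D"
proof -
  have no_Neg: "Neg i \<notin> d" for i
  proof
    assume i: "Neg i \<in> d"
    then have "i < n" "\<not> \<sigma> i"
      using d by (auto simp: cube_def)
    then have "Pos i \<notin> d"
      using d by (auto simp: cube_def)
    have "\<rho> \<in> dnf_states n D" if \<rho>: "\<rho> \<in> term_states n (d - {Neg i})" for \<rho>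
    proof -
      \<comment> \<open>As \<open>Pos i\<close> is not in \<open>d\<close>, lowering variable
        \<open>i\<close> falsifies no literal of \<open>d\<close>.\<close>
      have "lit_true (\<rho>(i := False)) l" if "l \<in> d" for l
        using that \<rho> \<open>Pos i \<notin> d\<close> by (cases l) (force simp: term_states_def)+
      then have "\<rho>(i := False) \<in> term_states n d"
        using \<rho> \<open>i < n\<close> by (auto simp: term_states_def states_iff)
      with implicant have *: "\<rho>(i := False) \<in> dnf_states n D" by auto
      show ?thesis
      proof (cases "\<rho> i")
        case True
        then have "\<rho> = (\<rho>(i := False))(i := True)" by (auto simp: fun_eq_iff)
        then show ?thesis
          using monotone_dnf_upd_True[OF mono * \<open>i < n\<close>] by metis
      next
        case False
        then have "\<rho>(i := False) = \<rho>" by (auto simp: fun_eq_iff)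
        with * show ?thesis by simp
      qed
    qed
    with prime[OF i] show False by auto
  qed
  \<comment> \<open>The least model of \<open>d\<close>: a positive literal holds in it exactly if
    it belongs to \<open>d\<close>.\<close>
  define \<tau> where "\<tau> = (\<lambda>i. if i < n then Pos i \<in> d else undefined)"
  have "lit_true \<tau> l" if "l \<in> d" for l
    using that d no_Neg by (cases l) (auto simp: \<tau>_def cube_def)
  then have "\<tau> \<in> term_states n d"
    by (auto simp: term_states_def states_iff \<tau>_def)
  then obtain t where t: "t \<in> set D" "\<tau> \<in> term_states n t"
    using implicant by (auto simp: dnf_states_def)
  have "t \<subseteq> d"
  proof
    fix l assume l: "l \<in> t"
    then obtain i where "l = Pos i" "i < n"
      using mono t(1) unfolding monotone_dnf_def by blast
    then show "l \<in> d"
      using l t(2) by (auto simp: term_states_def \<tau>_def)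
  qed
  moreover have "l \<in> t" if "l \<in> d" for l
  proof (rule ccontr)
    assume "l \<notin> t"
    then have "term_states n (d - {l}) \<subseteq> term_states n t"
      using \<open>t \<subseteq> d\<close> by (intro term_states_mono) auto
    then show False
      using prime[OF that] t(1) by (auto simp: dnf_states_def)
  qed
  ultimately have "t = d" by auto
  then show ?thesis using t(1) by simp
qed

section \<open>Progress of the machine\<close>

text \<open>
  The weight \<open>3\<close> leaves room for \<open>add_term\<close>, the only step without a check; the time may
  stay the same there, since the added term can be empty.
\<close>

fun progress :: "config \<Rightarrow> nat" where
  "progress (s, c) = 3 * (ind_checks c + bmc_checks c) + (case s of Loop _ \<Rightarrow> 1 | _ \<Rightarrow> 0)"

lemma itp_step_progress: "itp_step n \<delta> Bad k cfg cfg' \<Longrightarrow> progress cfg < progress cfg'"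
  by (induction rule: itp_step.induct) (auto simp: ind_check_def bmc_check_def tick_def)

lemma itp_step_exists:
  assumes "\<And>J. s \<noteq> Returned J" "s \<noteq> Failed"
  shows "\<exists>cfg'. itp_step n \<delta> Bad k (s, c) cfg'"
proof (cases s)
  case (Loop \<phi>)
  then show ?thesis
    by (cases "\<delta> `` \<phi> \<subseteq> \<phi>") (blast intro: itp_step.return itp_step.counterexample)+
next
  case (Cex \<phi> \<sigma>')
  then show ?thesis
    by (cases "reach_within \<delta> k {\<sigma>'} \<inter> Bad = {}") (blast intro: itp_step.fail itp_step.start_gen)+
next
  case (Gen \<phi> d L)
  show ?thesis
  proof (cases "L = {}")
    case True
    then show ?thesis using Gen itp_step.add_term by blast
  next
    case False
    then obtain l where "l \<in> L" by auto
    then show ?thesis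
      using Gen itp_step.drop_lit itp_step.keep_lit by metis
  qed
qed (use assms in auto)

section \<open>The invariant of a run\<close>

locale fenced_monotone =
  fixes n :: nat and Init :: fm and \<delta> :: trans and Bad :: fm and k :: nat and D :: dnf
  assumes invariant: "inductive_invariant n Init \<delta> Bad (dnf_states n D)"
    and fenced: "backwards_fenced n \<delta> Bad k (dnf_states n D)"
    and mono: "monotone_dnf n D"
begin

abbreviation I :: fm where
  "I \<equiv> dnf_states n D"

lemma reach_within_subset: "S \<subseteq> I \<Longrightarrow> reach_within \<delta> k S \<inter> Bad = {}"
  using reach_within_closed[of \<delta> I S k] invariant by (auto simp: inductive_invariant_def)

definition candidate :: "trm set \<Rightarrow> fm" where
  "candidate T = Init \<union> (\<Union>d\<in>T. term_states n d)"

lemma candidate_subset: "T \<subseteq> set D \<Longrightarrow> candidate T \<subseteq> I"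
  using invariant by (auto simp: candidate_def inductive_invariant_def dnf_states_def)

text \<open>
  \<open>T\<close> is the set of terms added so far. One iteration costs at most \<open>n + 1\<close> bounded checks and
  \<open>3 * n + 2\<close> time: two checks, \<open>n\<close> for the cube, and for each literal a check and then either
  its removal or, at the end, its being written to the candidate; the bounds in the \<open>Gen\<close> case
  charge the literals still to be tried in advance.
\<close>

fun run_inv :: "trm set \<Rightarrow> control \<Rightarrow> cost \<Rightarrow> bool" where
  "run_inv T (Loop \<phi>) c \<longleftrightarrow> \<phi> = candidate T \<and>
     ind_checks c \<le> card T \<and> bmc_checks c \<le> card T * (n + 1) \<and> time c \<le> card T * (3 * n + 2)"
| "run_inv T (Cex \<phi> \<sigma>') c \<longleftrightarrow> \<phi> = candidate T \<and> \<sigma>' \<in> I \<and> \<sigma>' \<notin> \<phi> \<and>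
     ind_checks c \<le> card T + 1 \<and> bmc_checks c \<le> card T * (n + 1) \<and>
     time c \<le> card T * (3 * n + 2) + 1"
| "run_inv T (Gen \<phi> d L) c \<longleftrightarrow> \<phi> = candidate T \<and>
     (\<exists>\<sigma>'. \<sigma>' \<in> I \<and> \<sigma>' \<notin> \<phi> \<and> d \<subseteq> cube n \<sigma>') \<and> L \<subseteq> d \<and>
     reach_within \<delta> k (term_states n d) \<inter> Bad = {} \<and>
     (\<forall>l\<in>d - L. reach_within \<delta> k (term_states n (d - {l})) \<inter> Bad \<noteq> {}) \<and>
     ind_checks c \<le> card T + 1 \<and> bmc_checks c + card L \<le> card T * (n + 1) + (n + 1) \<and>
     time c + card L + card d \<le> card T * (3 * n + 2) + (3 * n + 2)"
| "run_inv T (Returned \<phi>) c \<longleftrightarrow> \<phi> = candidate T \<and> \<delta> `` \<phi> \<subseteq> \<phi> \<and>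
     ind_checks c \<le> card T + 1 \<and> bmc_checks c \<le> card T * (n + 1) \<and>
     time c \<le> card T * (3 * n + 2) + 1"
| "run_inv T Failed c \<longleftrightarrow> False"

text \<open>The outcomes of the bounded checks become statements on implicants: reaching
  \<open>Bad\<close> shows that a term leaves \<open>I\<close>, as \<open>I\<close> is closed under
  \<open>\<delta>\<close> and avoids \<open>Bad\<close>; not reaching it gives inclusion through the
  fence.\<close>

lemma generalized_term:
  assumes \<sigma>: "\<sigma> \<in> I" "d \<subseteq> cube n \<sigma>" and safe: "reach_within \<delta> k (term_states n d) \<inter> Bad = {}"
    and min: "\<And>l. l \<in> d \<Longrightarrow> reach_within \<delta> k (term_states n (d - {l})) \<inter> Bad \<noteq> {}"
  shows "d \<in> set D" "\<sigma> \<in> term_states n d"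
proof -
  have "\<sigma> \<in> states n"
    using \<sigma>(1) by (auto simp: dnf_states_def term_states_def)
  then show *: "\<sigma> \<in> term_states n d"
    using term_states_mono[OF \<sigma>(2), of n] term_states_cube by blast
  show "d \<in> set D"
    using mono \<sigma>(2)
  proof (rule monotone_dnf_prime_implicant)
    show "term_states n d \<subseteq> I"
      by (rule fenced_term_subset[OF fenced \<sigma>(1) * safe])
    show "\<not> term_states n (d - {l}) \<subseteq> I" if "l \<in> d" for l
      using reach_within_subset min[OF that] by blast
  qed
qed

lemma run_inv_step:
  assumes "itp_step n \<delta> Bad k cfg cfg'" "run_inv T (fst cfg) (snd cfg)" "T \<subseteq> set D"
  shows "\<exists>T'\<subseteq>set D. run_inv T' (fst cfg') (snd cfg')"
  using assms
proof (induction rule: itp_step.induct)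
  case (return \<phi> c)
  then show ?case
    by (intro exI[of _ T]) (auto simp: ind_check_def)
next
  case (counterexample \<sigma> \<phi> \<sigma>' c)
  then have "\<sigma> \<in> I"
    using candidate_subset[of T] by auto
  with counterexample.hyps have "\<sigma>' \<in> I"
    using invariant unfolding inductive_invariant_def by blast
  with counterexample show ?case
    by (intro exI[of _ T]) (auto simp: ind_check_def)
next
  \<comment> \<open>Impossible: a run from a state of \<open>I\<close> stays in \<open>I\<close> and
    so avoids \<open>Bad\<close>.\<close>
  case (fail \<sigma>' \<phi> c)
  then show ?case
    using reach_within_subset[of "{\<sigma>'}"] by auto
next
  case (start_gen \<sigma>' \<phi> c)
  then have "\<sigma>' \<in> states n"
    by (auto simp: dnf_states_def term_states_def)
  \<comment> \<open>The cube holds at \<open>\<sigma>'\<close> alone, so the check of that state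
    also covers the initial term.\<close>
  with start_gen show ?case
    by (intro exI[of _ T]) (auto simp: term_states_cube card_cube bmc_check_def tick_def)
next
  case (drop_lit l L d \<phi> c)
  then have "finite d"
    by (auto intro: finite_subset[OF _ finite_cube])
  have "L \<subseteq> d" using drop_lit.prems by simp
  then have "finite L" "l \<in> d"
    using \<open>finite d\<close> drop_lit.hyps by (auto intro: finite_subset)
  \<comment> \<open>Positivity guards the truncated subtraction: one check and one removal are paid
    for by the decrease of \<open>card L\<close> and of \<open>card d\<close>.\<close>
  then have card: "card L > 0" "card d > 0"
    using \<open>finite d\<close> drop_lit.hyps(1) by (auto simp: card_gt_0_iff)
  \<comment> \<open>A literal found necessary stays so: fewer literals give more states, and
    \<open>Bad\<close> remains reachable.\<close>
  have "reach_within \<delta> k (term_states n (d - {l} - {l'})) \<inter> Bad \<noteq> {}"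
    if "l' \<in> d - {l} - (L - {l})" for l'
  proof -
    have "reach_within \<delta> k (term_states n (d - {l'})) \<inter> Bad \<noteq> {}"
      using drop_lit.prems that by auto
    moreover have "term_states n (d - {l'}) \<subseteq> term_states n (d - {l} - {l'})"
      by (intro term_states_mono) auto
    ultimately show ?thesis
      using reach_within_mono by blast
  qed
  then show ?case
    using drop_lit card \<open>l \<in> d\<close>
    by (intro exI[of _ T]) (auto simp: bmc_check_def tick_def card_Diff_singleton)
next
  case (keep_lit l L d \<phi> c)
  then obtain \<sigma> where "L \<subseteq> d" "d \<subseteq> cube n \<sigma>"
    by auto
  then have "finite L"
    using finite_cube finite_subset by metis
  then have "card L > 0"
    using keep_lit.hyps(1) by (auto simp: card_gt_0_iff)
  then show ?case
    using keep_lit by (intro exI[of _ T]) (auto simp: bmc_check_def card_Diff_singleton)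
next
  case (add_term \<phi> d c)
  then obtain \<sigma> where \<sigma>: "\<sigma> \<in> I" "\<sigma> \<notin> candidate T" "d \<subseteq> cube n \<sigma>" and \<phi>: "\<phi> = candidate T"
    by auto
  have d: "d \<in> set D" "\<sigma> \<in> term_states n d"
    using generalized_term[OF \<sigma>(1,3)] add_term.prems by auto
  \<comment> \<open>The counterexample satisfies \<open>d\<close> but not the candidate. The
    resulting growth of \<open>T\<close> pays for the iteration.\<close>
  then have "d \<notin> T"
    using \<sigma>(2) by (auto simp: candidate_def)
  moreover have "finite T"
    using add_term.prems by (auto intro: finite_subset)
  ultimately have "card (insert d T) = card T + 1"
    by simp
  moreover have "candidate (insert d T) = \<phi> \<union> term_states n d"
    by (auto simp: \<phi> candidate_def)
  ultimately show ?case
    using add_term.prems d by (intro exI[of _ "insert d T"]) (auto simp: tick_def)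
qed

lemma reachable_run_inv:
  assumes "itp_reachable n Init \<delta> Bad k cfg"
  obtains T where "T \<subseteq> set D" "run_inv T (fst cfg) (snd cfg)"
proof -
  have "\<exists>T\<subseteq>set D. run_inv T (fst cfg) (snd cfg)"
    using assms unfolding itp_reachable_def
  proof (induction rule: rtranclp_induct)
    case base
    show ?case
      by (intro exI[of _ "{}"]) (auto simp: itp_start_def candidate_def)
  next
    case (step cfg cfg')
    then show ?case using run_inv_step by blast
  qed
  then show thesis using that by blast
qed

section \<open>Cost bounds and termination\<close>

lemma reachable_cost:
  assumes "itp_reachable n Init \<delta> Bad k (s, c)"
  shows "ind_checks c \<le> length D + 1" "bmc_checks c \<le> (length D + 1) * (n + 1)"
    "time c \<le> (length D + 1) * (3 * n + 2)"
proof -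
  obtain T where T: "T \<subseteq> set D" "run_inv T s c"
    using assms by (auto elim: reachable_run_inv)
  \<comment> \<open>The terms in \<open>T\<close> are distinct members of \<open>D\<close>; the
    extra \<open>1\<close> covers an iteration in progress or the final inductiveness check.\<close>
  have "card T \<le> length D"
    using card_mono[OF _ T(1)] card_length[of D] by simp
  then have le: "card T + 1 \<le> length D + 1"
    by simp
  have *: "ind_checks c \<le> card T + 1 \<and> bmc_checks c \<le> (card T + 1) * (n + 1) \<and>
      time c \<le> (card T + 1) * (3 * n + 2)"
    using T(2) by (cases s) auto
  then show "ind_checks c \<le> length D + 1"
    using le by linarith
  show "bmc_checks c \<le> (length D + 1) * (n + 1)"
    using * mult_le_mono1[OF le, of "n + 1"] by linarith
  show "time c \<le> (length D + 1) * (3 * n + 2)"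
    using * mult_le_mono1[OF le, of "3 * n + 2"] by linarith
qed

lemma no_infinite_run:
  assumes "run 0 = itp_start Init" "\<And>i. itp_step n \<delta> Bad k (run i) (run (Suc i))"
  shows False
proof -
  have reach: "itp_reachable n Init \<delta> Bad k (run i)" for i
    unfolding itp_reachable_def
    by (induction i) (use assms in \<open>auto intro: rtranclp.rtrancl_into_rtrancl\<close>)
  have grow: "i \<le> progress (run i)" for i
  proof (induction i)
    case (Suc i)
    then show ?case using itp_step_progress[OF assms(2)[of i]] by linarith
  qed simp
  \<comment> \<open>Every step raises \<open>progress\<close>, while the bounds on checks cap it at
    \<open>?B\<close>; the last \<open>1\<close> is the contribution of \<open>Loop\<close>.\<close>
  let ?B = "3 * (length D + 1 + (length D + 1) * (n + 1)) + 1"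
  obtain s c where sc: "run (Suc ?B) = (s, c)"
    by fastforce
  have "itp_reachable n Init \<delta> Bad k (s, c)"
    unfolding sc[symmetric] by (rule reach)
  note cost = reachable_cost[OF this]
  have "progress (s, c) \<le> 3 * (ind_checks c + bmc_checks c) + 1"
    by (cases s) auto
  also have "\<dots> \<le> ?B"
    using cost(1,2) by (intro add_mono mult_le_mono) simp_all
  finally show False
    using grow[of "Suc ?B"] unfolding sc by (metis Suc_n_not_le_n order_trans)
qed

lemma converges: "itp_converges n Init \<delta> Bad k"
  unfolding itp_converges_def
proof (intro conjI allI impI)
  show "\<not> (\<exists>run. run 0 = itp_start Init \<and> (\<forall>i. itp_step n \<delta> Bad k (run i) (run (Suc i))))"
    using no_infinite_run by blast
next
  fix cfg
  assume *: "itp_reachable n Init \<delta> Bad k cfg \<and> \<not> (\<exists>cfg'. itp_step n \<delta> Bad k cfg cfg')"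
  obtain s c where cfg: "cfg = (s, c)" by fastforce
  obtain T where T: "T \<subseteq> set D" "run_inv T s c"
    using * cfg by (auto elim: reachable_run_inv)
  have "s \<noteq> Failed" using T(2) by auto
  then obtain J where J: "s = Returned J"
    using itp_step_exists[of s n \<delta> Bad k c] * cfg by blast
  have "inductive_invariant n Init \<delta> Bad J"
    using T J candidate_subset[OF T(1)] invariant
    by (auto simp: inductive_invariant_def candidate_def)
  then show "\<exists>J c. cfg = (Returned J, c) \<and> inductive_invariant n Init \<delta> Bad J"
    using cfg J by blast
qed

end

theorem theorem5p6:
  "\<exists>C :: nat. \<forall>(n :: nat) (Init :: fm) (\<delta> :: trans) (Bad :: fm) (k :: nat) (I :: fm) (D :: dnf) (m :: nat).
     transition_system n Init \<delta> Bad \<longrightarrow>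
     inductive_invariant n Init \<delta> Bad I \<longrightarrow>
     backwards_fenced n \<delta> Bad k I \<longrightarrow>
     monotone_dnf n D \<longrightarrow> I = dnf_states n D \<longrightarrow> length D = m \<longrightarrow>
     itp_converges n Init \<delta> Bad k \<and>
     (\<forall>s c. itp_reachable n Init \<delta> Bad k (s, c) \<longrightarrow>
        ind_checks c \<le> C * m \<and> bmc_checks c \<le> C * (m * n) \<and> time c \<le> C * (m * n))"
proof (rule exI[of _ 10], intro allI impI)
  fix n Init \<delta> Bad k I D m
  assume ts: "transition_system n Init \<delta> Bad" and inv: "inductive_invariant n Init \<delta> Bad I"
    and fenced: "backwards_fenced n \<delta> Bad k I" and mono: "monotone_dnf n D"
    and I: "I = dnf_states n D" and m: "length D = m"
  interpret fenced_monotone n Init \<delta> Bad k D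
    using inv fenced mono I by unfold_locales auto
  \<comment> \<open>Without variables there is only one state, so \<open>Bad\<close> would be empty
    or everything.\<close>
  have "n \<noteq> 0"
    using ts by (auto simp: transition_system_def states_def)
  have "I \<noteq> {}"
    using ts inv by (auto simp: transition_system_def inductive_invariant_def)
  then have "m \<noteq> 0"
    using m by (auto simp: I dnf_states_def)
  have "ind_checks c \<le> 10 * m \<and> bmc_checks c \<le> 10 * (m * n) \<and> time c \<le> 10 * (m * n)"
    if "itp_reachable n Init \<delta> Bad k (s, c)" for s c
  proof -
    note cost = reachable_cost[OF that, unfolded m]
    \<comment> \<open>For positive \<open>m\<close> and \<open>n\<close> the additive constants are
      absorbed; the time bound gives the constant 10 as 2 times 5.\<close>
    have "(m + 1) * (n + 1) \<le> (2 * m) * (2 * n)" "(m + 1) * (3 * n + 2) \<le> (2 * m) * (5 * n)"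
      using \<open>m \<noteq> 0\<close> \<open>n \<noteq> 0\<close> by (intro mult_le_mono; simp)+
    then show ?thesis
      using cost \<open>m \<noteq> 0\<close> by auto
  qed
  then show "itp_converges n Init \<delta> Bad k \<and>
     (\<forall>s c. itp_reachable n Init \<delta> Bad k (s, c) \<longrightarrow>
        ind_checks c \<le> 10 * m \<and> bmc_checks c \<le> 10 * (m * n) \<and> time c \<le> 10 * (m * n))"
    using converges by blast
qed

end
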